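(* Let $\mathrm{S}\in\{\mathbb{N},\mathbb{R}\}$, $p\in\mathbb{N}$ and $g\in\mathcal{D}^p_{\mathrm{S}}\cap\mathcal{K}^p$. The following assertions hold. (a) $g\in\mathcal{R}^p_{\mathrm{S}}$. (b) The sequence $n\mapsto f^p_n[g](x)$ converges for every $x>0$, and the function $f\colon\mathbb{R}_+\to\mathbb{R}$ defined by $f(x)=\lim_{n\to\infty}f^p_n[g](x)$, $x>0$, is a solution to the equation $\Delta f=g$ that is $p$-concave (resp. $p$-convex) on any unbounded subinterval $I$ of $\mathbb{R}_+$ on which $g$ is $p$-convex (resp. $p$-concave). Moreover, $f(1)=0$ and, for such $I$, $$|f^p_n[g](x)-f(x)|\le\lceil x\rceil\left|\binom{x-1}{p}\right|\left|\Delta^pg(n)\right|,\qquad x>0,\ n\in I\cap\mathbb{N}^*.$$ If $p\ge 1$, we also have the tighter inequality $$|f^p_n[g](x)-f(x)|\le\left|\binom{x-1}{p}\right|\left|\Delta^{p-1}g(n+x)-\Delta^{p-1}g(n)\right|,\qquad x>0,\ n\in I\cap\mathbb{N}^*.$$ (c) The sequence $n\mapsto f^p_n[g]$ converges uniformly on any bounded subset of $\mathbb{R}_+$ to $f$.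
   Context: $\mathbb{N}=\{0,1,2,\ldots\}$, $\mathbb{N}^*=\{1,2,\ldots\}$, $\mathbb{R}_+=(0,\infty)$, and $\Delta f(x)=f(x+1)-f(x)$. For $\mathrm{S}\in\{\mathbb{N},\mathbb{R}\}$, $x\to_{\mathrm{S}}\infty$ means that $x$ tends to $+\infty$ taking values only in $\mathrm{S}$. For an integer $p\ge -1$, a function $f\colon I\to\mathbb{R}$ on a real interval $I$ is $p$-convex (resp. $p$-concave) if for all $x_0<\cdots<x_{p+1}$ in $I$ the divided difference $f[x_0,\ldots,x_{p+1}]$ is $\ge 0$ (resp. $\le 0$), where $f[x_0,\ldots,x_n]=\sum_{k=0}^n f(x_k)/\prod_{j\ne k}(x_k-x_j)$. $\mathcal{K}^p$ is the set of functions $\mathbb{R}_+\to\mathbb{R}$ that are $p$-convex on some $[a,\infty)$ or $p$-concave on some $[a,\infty)$. $\mathcal{D}^p_{\mathrm{S}}$ is the set of $g\colon\mathbb{R}_+\to\mathbb{R}$ with $\Delta^pg(x)\to 0$ as $x\to_{\mathrm{S}}\infty$. For $a>0$, $\rho^p_a[g](x)=g(x+a)-\sum_{j=0}^{p-1}\binom{x}{j}\Delta^jg(a)$ for $x\ge 0$. $\mathcal{R}^p_{\mathrm{S}}$ is the set of $g\colon\mathbb{R}_+\to\mathbb{R}$ such that, for each $x>0$, $\rho^p_a[g](x)\to 0$ as $a\to_{\mathrm{S}}\infty$. For $n\in\mathbb{N}^*$, $$f^p_n[g](x)=-g(x)+\sum_{k=1}^{n-1}(g(k)-g(x+k))+\sum_{j=1}^p\binom{x}{j}\Delta^{j-1}g(n),\qquad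 x>0.$$ *)

theory Defs
  imports "HOL-Analysis.Analysis"
begin

text \<open>
  A function from the positive half-line to the reals is represented by a total function
  \<open>real \<Rightarrow> real\<close>. Its values at nonpositive arguments are junk: no notion below looks at them
  when it is used with positive arguments (and positive indices \<open>n\<close>).
\<close>

definition forward_diff :: "(real \<Rightarrow> real) \<Rightarrow> real \<Rightarrow> real" where
  "forward_diff f x = f (x + 1) - f x"

text \<open>The filter of \<open>x \<rightarrow> \<infinity>\<close> with \<open>x\<close> restricted to \<open>S\<close>; used with \<open>S = \<nat>\<close> and \<open>S = \<real>\<close>.\<close>

definition at_top_in :: "real set \<Rightarrow> real filter" where
  "at_top_in S = inf at_top (principal S)"

definition divided_difference :: "nat \<Rightarrow> (real \<Rightarrow> real) \<Rightarrow> (nat \<Rightarrow> real) \<Rightarrow> real" where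
  "divided_difference n f x = (\<Sum>k\<le>n. f (x k) / (\<Prod>j\<in>{..n} - {k}. x k - x j))"

definition p_convex_on :: "nat \<Rightarrow> real set \<Rightarrow> (real \<Rightarrow> real) \<Rightarrow> bool" where
  "p_convex_on p I f \<longleftrightarrow>
     (\<forall>x. x ` {..p + 1} \<subseteq> I \<and> strict_mono_on {..p + 1} x \<longrightarrow> divided_difference (p + 1) f x \<ge> 0)"

definition p_concave_on :: "nat \<Rightarrow> real set \<Rightarrow> (real \<Rightarrow> real) \<Rightarrow> bool" where
  "p_concave_on p I f \<longleftrightarrow>
     (\<forall>x. x ` {..p + 1} \<subseteq> I \<and> strict_mono_on {..p + 1} x \<longrightarrow> divided_difference (p + 1) f x \<le> 0)"

definition K_class :: "nat \<Rightarrow> (real \<Rightarrow> real) set" where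
  "K_class p = {f. (\<exists>a>0. p_convex_on p {a..} f) \<or> (\<exists>a>0. p_concave_on p {a..} f)}"

definition D_class :: "nat \<Rightarrow> real set \<Rightarrow> (real \<Rightarrow> real) set" where
  "D_class p S = {g. ((forward_diff ^^ p) g \<longlongrightarrow> 0) (at_top_in S)}"

definition rho :: "nat \<Rightarrow> real \<Rightarrow> (real \<Rightarrow> real) \<Rightarrow> real \<Rightarrow> real" where
  "rho p a g x = g (x + a) - (\<Sum>j<p. (x gchoose j) * (forward_diff ^^ j) g a)"

definition R_class :: "nat \<Rightarrow> real set \<Rightarrow> (real \<Rightarrow> real) set" where
  "R_class p S = {g. \<forall>x>0. ((\<lambda>a. rho p a g x) \<longlongrightarrow> 0) (at_top_in S)}"

definition f_seq :: "nat \<Rightarrow> (real \<Rightarrow> real) \<Rightarrow> nat \<Rightarrow> real \<Rightarrow> real" where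
  "f_seq p g n x = - g x + (\<Sum>k\<in>{1..<n}. g (real k) - g (x + real k))
     + (\<Sum>j=1..p. (x gchoose j) * (forward_diff ^^ (j - 1)) g (real n))"

definition f_lim :: "nat \<Rightarrow> (real \<Rightarrow> real) \<Rightarrow> real \<Rightarrow> real" where
  "f_lim p g x = lim (\<lambda>n. f_seq p g n x)"

definition unbounded_pos_interval :: "real set \<Rightarrow> bool" where
  "unbounded_pos_interval I \<longleftrightarrow> is_interval I \<and> I \<subseteq> {0<..} \<and> \<not> bounded I"

end

theory Submission
  imports Defs
begin

text \<open>
  The theorem rests on one estimate. The quantity \<open>rho (Suc p) a f x\<close> is the error at \<open>a + x\<close> of
  the polynomial interpolating \<open>f\<close> at \<open>a, a + 1, \<dots>, a + p\<close>, so it equals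
  \<open>x (x - 1) \<dots> (x - p)\<close> times the divided difference \<open>d\<close> of \<open>f\<close> at these \<open>p + 1\<close> nodes and
  \<open>a + x\<close>. If \<open>f\<close> is \<open>p\<close>-convex then \<open>d \<ge> 0\<close>. On the other hand \<open>x d\<close> is a difference of two divided
  differences of order \<open>p\<close>, and these are nondecreasing in each node; pushing all the nodes up by \<open>x\<close>
  gives \<open>x d \<le> (\<Delta>\<^sup>p f (a + x) - \<Delta>\<^sup>p f a) / p!\<close>. Hence (\<open>abs_rho_le\<close>)
  \<open>\<bar>rho (Suc p) a f x\<bar> \<le> \<bar>x - 1 gchoose p\<bar> (\<Delta>\<^sup>p f (a + x) - \<Delta>\<^sup>p f a)\<close>,
  and \<open>x\<close> may be replaced by \<open>\<lceil>x\<rceil>\<close> on the right, because \<open>\<Delta>\<^sup>p f\<close> is nondecreasing.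

  The estimate is used twice, for a convex \<open>g\<close> with \<open>\<Delta>\<^sup>p g \<rightarrow> 0\<close>. Applied to \<open>g\<close> itself, it shows that
  \<open>rho p a g x \<rightarrow> 0\<close>; moreover \<open>f_seq p g (n + 1) x - f_seq p g n x = - rho (Suc p) n g x\<close>, and the
  bounds with \<open>\<lceil>x\<rceil>\<close> telescope over \<open>n\<close> into \<open>\<lceil>x\<rceil>\<close> copies of \<open>\<Delta>\<^sup>p g\<close>
  (\<open>abs_f_seq_diff_le\<close>). This gives convergence, the first error bound and, the factor depending on
  \<open>x\<close> being locally bounded, uniform convergence on bounded sets. The difference equation for the limit
  \<open>f\<close> follows from \<open>rho p n g x \<rightarrow> 0\<close>, and \<open>f\<close> is \<open>p\<close>-concave because, up to a polynomial of degree at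
  most \<open>p\<close>, each \<open>f_seq p g n\<close> is minus a sum of translates of \<open>g\<close>.
  Finally \<open>\<Delta> f = g\<close> and \<open>f 1 = 0\<close> give \<open>f_seq p g n x - f x = - rho (Suc p) n f x\<close>, so that the same estimate, applied this time
  to \<open>-f\<close>, is the tighter bound, as \<open>\<Delta>\<^sup>p f = \<Delta>\<^sup>p\<^sup>-\<^sup>1 g\<close>.

  A concave \<open>g\<close> is reduced to the convex \<open>-g\<close>; everything in sight is linear in \<open>g\<close>.
\<close>

section \<open>Divided differences over finite sets of nodes\<close>

text \<open>
  A divided difference is symmetric in its nodes. With a set of nodes as its argument the symmetry is
  automatic, and nodes can be exchanged without keeping them sorted.
\<close>

definition dd_set :: "(real \<Rightarrow> real) \<Rightarrow> real set \<Rightarrow> real" where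
  "dd_set f X = (\<Sum>x\<in>X. f x / (\<Prod>y\<in>X - {x}. x - y))"

lemma divided_difference_eq_dd_set:
  assumes "inj_on x {..n}"
  shows "divided_difference n f x = dd_set f (x ` {..n})"
proof -
  have "(\<Prod>y\<in>x ` {..n} - {x k}. x k - y) = (\<Prod>j\<in>{..n} - {k}. x k - x j)" if "k \<le> n" for k
  proof -
    have "x ` {..n} - {x k} = x ` ({..n} - {k})"
      using assms that by (auto simp: inj_on_def)
    moreover have "inj_on x ({..n} - {k})"
      using assms by (rule inj_on_subset) auto
    ultimately show ?thesis
      by (simp add: prod.reindex)
  qed
  then show ?thesis
    using assms by (simp add: divided_difference_def dd_set_def sum.reindex)
qed

lemma finite_set_strict_mono_enumeration:
  fixes X :: "real set"
  assumes "finite X" "card X = Suc n"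
  obtains x where "strict_mono_on {..n} x" "x ` {..n} = X"
proof
  let ?x = "\<lambda>i. sorted_list_of_set X ! i"
  have len: "length (sorted_list_of_set X) = Suc n"
    using assms by simp
  show "strict_mono_on {..n} ?x"
    using len by (auto intro!: strict_mono_onI sorted_wrt_nth_less[OF strict_sorted_list_of_set])
  show "?x ` {..n} = X"
    using len assms(1) set_sorted_list_of_set[OF assms(1)]
    by (auto simp: set_conv_nth lessThan_Suc_atMost[symmetric])
qed

lemma p_convex_on_iff_dd_set:
  "p_convex_on p I f \<longleftrightarrow> (\<forall>X\<subseteq>I. finite X \<and> card X = p + 2 \<longrightarrow> dd_set f X \<ge> 0)" (is "?L \<longleftrightarrow> ?R")
proof
  assume L: ?L
  show ?R
  proof (intro allI impI)
    fix X assume X: "X \<subseteq> I" "finite X \<and> card X = p + 2"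
    then obtain x where x: "strict_mono_on {..p+1} x" "x ` {..p+1} = X"
      using finite_set_strict_mono_enumeration[of X "p+1"] by auto
    with L X show "dd_set f X \<ge> 0"
      using divided_difference_eq_dd_set[OF strict_mono_on_imp_inj_on[OF x(1)], of f]
      unfolding p_convex_on_def by metis
  qed
next
  assume R: ?R
  show ?L
    unfolding p_convex_on_def
  proof (intro allI impI)
    fix x assume x: "x ` {..p+1} \<subseteq> I \<and> strict_mono_on {..p+1} x"
    then have inj: "inj_on x {..p+1}"
      using strict_mono_on_imp_inj_on by blast
    then have "card (x ` {..p+1}) = p + 2"
      by (subst card_image) auto
    with R x show "0 \<le> divided_difference (p+1) f x"
      unfolding divided_difference_eq_dd_set[OF inj] by blast
  qed
qed

lemma p_concave_on_iff_minus: "p_concave_on p I f \<longleftrightarrow> p_convex_on p I (\<lambda>x. - f x)"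
proof -
  have "divided_difference n (\<lambda>x. - f x) x = - divided_difference n f x" for n x
    by (simp add: divided_difference_def sum_negf)
  then show ?thesis
    by (simp add: p_concave_on_def p_convex_on_def)
qed

lemma p_convex_on_subset: "p_convex_on p I f \<Longrightarrow> J \<subseteq> I \<Longrightarrow> p_convex_on p J f"
  unfolding p_convex_on_def by blast

lemma prod_diff_insert:
  fixes X :: "real set"
  assumes "finite X" "b \<notin> X" "x \<in> X"
  shows "(\<Prod>y\<in>insert b X - {x}. x - y) = (x - b) * (\<Prod>y\<in>X - {x}. x - y)"
proof -
  have "insert b X - {x} = insert b (X - {x})"
    using assms by auto
  then show ?thesis
    using assms by simp
qed

lemma dd_set_insert:
  assumes "finite X" "b \<notin> X"
  shows "dd_set f (insert b X) =
    f b / (\<Prod>y\<in>X. b - y) + (\<Sum>x\<in>X. f x / ((x - b) * (\<Prod>y\<in>X - {x}. x - y)))"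
  using assms prod_diff_insert[OF assms] by (simp add: dd_set_def)

text \<open>
  The usual recursion for divided differences: both sides agree on the coefficient of every \<open>f x\<close>, by
  \<open>1 / (x - b) - 1 / (x - a) = (b - a) / ((x - a) (x - b))\<close> at the common nodes.
\<close>

lemma dd_set_recursion:
  assumes "finite X" "a \<notin> X" "b \<notin> X" "a \<noteq> b"
  shows "(b - a) * dd_set f (insert a (insert b X)) = dd_set f (insert b X) - dd_set f (insert a X)"
proof -
  let ?P = "\<lambda>x. (\<Prod>y\<in>X - {x}. x - y)"
  have summand: "(b - a) * (f x / ((x - a) * ((x - b) * ?P x)))
      = f x / ((x - b) * ?P x) - f x / ((x - a) * ?P x)" if "x \<in> X" for x
  proof -
    have "x \<noteq> a" "x \<noteq> b"
      using that assms by auto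
    then have "f x / (x - b) - f x / (x - a) = (b - a) * (f x / ((x - a) * (x - b)))"
      by (simp add: field_simps)
    then have "f x / (x - b) / ?P x - f x / (x - a) / ?P x = (b - a) * (f x / ((x - a) * (x - b))) / ?P x"
      by (simp only: diff_divide_distrib[symmetric])
    then show ?thesis
      by (simp add: mult.assoc)
  qed
  have nz: "(\<Prod>y\<in>X. a - y) \<noteq> 0" "(\<Prod>y\<in>X. b - y) \<noteq> 0"
    using assms by auto
  have "dd_set f (insert a (insert b X)) = f a / ((a - b) * (\<Prod>y\<in>X. a - y))
      + (f b / ((b - a) * (\<Prod>y\<in>X. b - y)) + (\<Sum>x\<in>X. f x / ((x - a) * ((x - b) * ?P x))))"
    using assms by (subst dd_set_insert) (auto simp: prod_diff_insert)
  then have "(b - a) * dd_set f (insert a (insert b X)) =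
      (b - a) * (f a / ((a - b) * (\<Prod>y\<in>X. a - y))) + (b - a) * (f b / ((b - a) * (\<Prod>y\<in>X. b - y)))
      + (\<Sum>x\<in>X. (b - a) * (f x / ((x - a) * ((x - b) * ?P x))))"
    by (simp add: algebra_simps sum_distrib_left)
  also have "(\<Sum>x\<in>X. (b - a) * (f x / ((x - a) * ((x - b) * ?P x))))
      = (\<Sum>x\<in>X. f x / ((x - b) * ?P x)) - (\<Sum>x\<in>X. f x / ((x - a) * ?P x))"
    using summand by (simp add: sum_subtractf)
  also have "(b - a) * (f a / ((a - b) * (\<Prod>y\<in>X. a - y))) = - (f a / (\<Prod>y\<in>X. a - y))"
    using assms nz by (simp add: field_simps)
  also have "(b - a) * (f b / ((b - a) * (\<Prod>y\<in>X. b - y))) = f b / (\<Prod>y\<in>X. b - y)"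
    using assms by simp
  finally show ?thesis
    using assms by (simp add: dd_set_insert)
qed

text \<open>
  The factor \<open>x - c\<close> kills the node \<open>c\<close> and cancels against the denominators of the others. This is
  what lets the degree of a polynomial be lowered by one together with the number of nodes.
\<close>

lemma dd_set_mult_linear:
  assumes "finite X" "c \<notin> X"
  shows "dd_set (\<lambda>x. (x - c) * h x) (insert c X) = dd_set h X"
proof -
  have "(x - c) * h x / ((x - c) * P) = h x / P" if "x \<in> X" for x P
    using that assms by auto
  then show ?thesis
    using assms by (simp add: dd_set_insert) (simp add: dd_set_def)
qed

lemma dd_set_add: "dd_set (\<lambda>x. f x + h x) X = dd_set f X + dd_set h X"
  by (simp add: dd_set_def sum.distrib add_divide_distrib)

lemma dd_set_mult_left: "dd_set (\<lambda>x. c * f x) X = c * dd_set f X"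
  by (simp add: dd_set_def sum_distrib_left)

lemma dd_set_minus: "dd_set (\<lambda>x. - f x) X = - dd_set f X"
  by (simp add: dd_set_def sum_negf)

lemma dd_set_sum: "dd_set (\<lambda>x. \<Sum>i\<in>A. f i x) X = (\<Sum>i\<in>A. dd_set (f i) X)"
  by (simp add: dd_set_def sum_divide_distrib) (rule sum.swap)

lemma dd_set_shift: "dd_set (\<lambda>x. f (x + c)) X = dd_set f ((\<lambda>x. x + c) ` X)"
proof -
  have "(\<Prod>y\<in>(\<lambda>x. x + c) ` X - {x + c}. x + c - y) = (\<Prod>y\<in>X - {x}. x - y)" for x
  proof -
    have "(\<lambda>x. x + c) ` X - {x + c} = (\<lambda>x. x + c) ` (X - {x})"
      by auto
    then show ?thesis
      by (simp add: prod.reindex inj_on_def)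
  qed
  then show ?thesis
    by (simp add: dd_set_def sum.reindex inj_on_def)
qed

lemma dd_set_one:
  assumes "finite X" "card X \<ge> 2"
  shows "dd_set (\<lambda>x. 1) X = 0"
  using assms
proof (induction "card X" arbitrary: X rule: less_induct)
  case less
  obtain a Y where a: "X = insert a Y" "a \<notin> Y" "card Y \<ge> 1"
    using less.prems by (metis Suc_le_mono card_Suc_eq numeral_2_eq_2 One_nat_def Suc_le_D)
  then obtain b Z where b: "Y = insert b Z" "b \<notin> Z"
    by (metis One_nat_def Suc_le_D card_Suc_eq)
  have fin: "finite Z"
    using a b less.prems by simp
  have ab: "a \<noteq> b" "a \<notin> Z"
    using a b by auto
  have "(b - a) * dd_set (\<lambda>x. 1) X = dd_set (\<lambda>x. 1) (insert b Z) - dd_set (\<lambda>x. 1) (insert a Z)"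
    using dd_set_recursion[OF fin ab(2) b(2) ab(1)] a b by simp
  also have "\<dots> = 0"
  proof (cases "Z = {}")
    case True
    then show ?thesis by (simp add: dd_set_def)
  next
    case False
    then have "card Z \<ge> 1"
      using fin by (simp add: Suc_leI card_gt_0_iff)
    then have "dd_set (\<lambda>x. 1) (insert b Z) = 0" "dd_set (\<lambda>x. 1) (insert a Z) = 0"
      using fin a b ab by (auto intro!: less.hyps)
    then show ?thesis by simp
  qed
  finally show ?case
    using ab by simp
qed

text \<open>
  Divided differences of order above \<open>j\<close> annihilate polynomials of degree \<open>j\<close>. In the induction step
  the factor \<open>x - j\<close> of \<open>x gchoose Suc j\<close> is split as \<open>(x - c) + (c - j)\<close> for some node \<open>c\<close>.
\<close>

lemma dd_set_gchoose:
  assumes "finite X" "card X \<ge> j + 2"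
  shows "dd_set (\<lambda>x. x gchoose j) X = 0"
  using assms
proof (induction j arbitrary: X)
  case 0
  then show ?case by (simp add: dd_set_one)
next
  case (Suc j)
  obtain c Y where c: "X = insert c Y" "c \<notin> Y" "card Y \<ge> j + 2" "finite Y"
    using Suc.prems by (metis Suc_le_mono add_Suc card_Suc_eq finite_insert Suc_le_D)
  have "(\<lambda>x::real. x gchoose Suc j)
      = (\<lambda>x. (1 / (real j + 1)) * ((x - c) * (x gchoose j) + (c - real j) * (x gchoose j)))"
    by (intro ext) (simp add: gbinomial_prod_rev field_simps)
  then have "dd_set (\<lambda>x. x gchoose Suc j) X = (1 / (real j + 1)) *
      (dd_set (\<lambda>x. (x - c) * (x gchoose j)) X + (c - real j) * dd_set (\<lambda>x. x gchoose j) X)"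
    by (simp only: dd_set_mult_left dd_set_add)
  also have "\<dots> = 0"
    using c Suc.IH[of Y] Suc.IH[of X] Suc.prems by (simp add: dd_set_mult_linear)
  finally show ?case .
qed

text \<open>
  Divided differences of order \<open>p\<close> of a \<open>p\<close>-convex function grow with the nodes: by the recursion,
  replacing a node \<open>s i\<close> by a larger \<open>t i\<close> changes the value by \<open>t i - s i\<close> times a nonnegative divided
  difference of order \<open>p + 1\<close>. The nodes are replaced from the last index down, and the hypothesis that
  \<open>s i \<noteq> t j\<close> for \<open>i < j\<close> prevents a new node from colliding with one that is still in place. The
  order of the indices is left free because one of the nodes to which the lemma is applied may lie
  anywhere among the others.
\<close>

lemma dd_set_mono_nodes:
  assumes convex: "p_convex_on p I f"
    and nodes: "s ` {..p} \<subseteq> I" "t ` {..p} \<subseteq> I"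
    and inj: "inj_on s {..p}" "inj_on t {..p}"
    and le: "\<And>i. i \<le> p \<Longrightarrow> s i \<le> t i"
    and neq: "\<And>i j. i < j \<Longrightarrow> j \<le> p \<Longrightarrow> s i \<noteq> t j"
  shows "dd_set f (s ` {..p}) \<le> dd_set f (t ` {..p})"
proof -
  \<comment> \<open>The set of nodes when those of index at least \<open>m\<close> have been replaced.\<close>
  define M where "M m = s ` {..<m} \<union> t ` {m..p}" for m
  have step: "dd_set f (M (Suc m)) \<le> dd_set f (M m)" if m: "m \<le> p" for m
  proof (cases "s m = t m")
    case True
    have "{m..p} = insert m {Suc m..p}"
      using m by auto
    then have "M (Suc m) = M m"
      using True by (auto simp: M_def lessThan_Suc)
    then show ?thesis by simp
  next
    case False
    define X where "X = s ` {..<m} \<union> t ` {Suc m..p}"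
    have "{m..p} = insert m {Suc m..p}"
      using m by auto
    then have M: "M m = insert (t m) X" "M (Suc m) = insert (s m) X"
      by (auto simp: M_def X_def lessThan_Suc)
    have notin: "s m \<notin> X" "t m \<notin> X"
      using m inj neq by (auto simp: X_def inj_on_def) (metis order.strict_implies_order order.strict_trans2 less_irrefl le_trans atMost_iff Suc_leD Suc_n_not_le_n)+
    have fin: "finite X"
      by (simp add: X_def)
    have "card X = card (s ` {..<m}) + card (t ` {Suc m..p})"
      unfolding X_def using neq by (intro card_Un_disjoint) fastforce+
    also have "\<dots> = m + (p - m)"
      using m by (subst (1 2) card_image) (auto intro: inj_on_subset[OF inj(1)] inj_on_subset[OF inj(2)])
    finally have "card X = p"
      using m by simp
    then have "card (insert (s m) (insert (t m) X)) = p + 2"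
      using fin notin False by simp
    moreover have "insert (s m) (insert (t m) X) \<subseteq> I"
      using nodes m by (auto simp: X_def)
    ultimately have "0 \<le> dd_set f (insert (s m) (insert (t m) X))"
      using convex fin by (simp add: p_convex_on_iff_dd_set)
    then have "0 \<le> (t m - s m) * dd_set f (insert (s m) (insert (t m) X))"
      using le[OF m] by simp
    then show ?thesis
      using dd_set_recursion[OF fin notin False, of f] M by simp
  qed
  have "dd_set f (M m) \<le> dd_set f (M 0)" if "m \<le> Suc p" for m
    using that by (induction m) (auto intro: order_trans[OF step])
  from this[of "Suc p"] show ?thesis
    by (simp add: M_def lessThan_Suc_atMost atLeast0AtMost)
qed

section \<open>Equidistant nodes and the interpolation remainder\<close>

definition grid :: "real \<Rightarrow> nat \<Rightarrow> real set" where
  "grid a n = (\<lambda>i. a + real i) ` {..<n}"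

lemma grid_Suc: "grid a (Suc n) = insert (a + real n) (grid a n)"
  by (auto simp: grid_def lessThan_Suc)

lemma grid_Suc_left: "grid a (Suc n) = insert a (grid (a + 1) n)"
  unfolding grid_def lessThan_Suc_eq_insert_0 by (auto simp: image_image algebra_simps)

lemma finite_grid [simp]: "finite (grid a n)"
  by (simp add: grid_def)

lemma dd_set_grid: "dd_set f (grid a (Suc n)) = (forward_diff ^^ n) f a / fact n"
proof (induction n arbitrary: a)
  case 0
  then show ?case by (simp add: grid_def dd_set_def lessThan_Suc)
next
  case (Suc n)
  let ?X = "grid (a + 1) n"
  have notin: "a \<notin> ?X" "a + 1 + real n \<notin> ?X" "a \<noteq> a + 1 + real n"
    by (auto simp: grid_def)
  have "(1 + real n) * dd_set f (grid a (Suc (Suc n)))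
      = dd_set f (grid (a + 1) (Suc n)) - dd_set f (grid a (Suc n))"
    using dd_set_recursion[OF finite_grid notin, of f]
    unfolding grid_Suc[of "a + 1"] grid_Suc_left[of a] by (simp add: algebra_simps)
  then have "real (Suc n) * dd_set f (grid a (Suc (Suc n))) = (forward_diff ^^ Suc n) f a / fact n"
    using forward_diff_def[of "(forward_diff ^^ n) f" a] by (simp add: Suc.IH diff_divide_distrib)
  then have "dd_set f (grid a (Suc (Suc n))) = (forward_diff ^^ Suc n) f a / fact n / real (Suc n)"
    by (simp add: eq_divide_eq mult.commute del: of_nat_Suc)
  then show ?case
    by (simp add: mult.commute del: of_nat_Suc funpow.simps)
qed

text \<open>
  The sum subtracted in \<open>rho n a f x\<close> is Newton's form of the polynomial interpolating \<open>f\<close> on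
  \<open>grid a n\<close>, taken at \<open>a + x\<close>; this is the classical expression for its error. Each further term of
  Newton's form is absorbed by one step of the recursion.
\<close>

lemma rho_eq_newton_remainder:
  assumes "x \<notin> real ` {..<n}"
  shows "rho n a f x = (\<Prod>i<n. x - real i) * dd_set f (insert (a + x) (grid a n))"
  using assms
proof (induction n)
  case 0
  then show ?case by (simp add: rho_def grid_def dd_set_def add.commute)
next
  case (Suc n)
  have notin: "a + real n \<notin> grid a n" "a + x \<notin> grid a n" "a + real n \<noteq> a + x"
    using Suc.prems by (auto simp: grid_def)
  have rec: "(x - real n) * dd_set f (insert (a + x) (grid a (Suc n)))
     = dd_set f (insert (a + x) (grid a n)) - dd_set f (grid a (Suc n))"
    using dd_set_recursion[OF finite_grid notin, of f] by (simp add: grid_Suc insert_commute)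
  have "x gchoose n = (\<Prod>i<n. x - real i) / fact n"
    by (simp add: gbinomial_prod_rev lessThan_atLeast0)
  then have "rho (Suc n) a f x
      = rho n a f x - (\<Prod>i<n. x - real i) * dd_set f (grid a (Suc n))"
    by (simp add: rho_def dd_set_grid)
  also have "\<dots> = (\<Prod>i<n. x - real i) * ((x - real n) * dd_set f (insert (a + x) (grid a (Suc n))))"
  proof -
    have "x \<notin> real ` {..<n}"
      using Suc.prems by auto
    from Suc.IH[OF this] show ?thesis
      unfolding rec by (simp add: algebra_simps)
  qed
  finally show ?case by simp
qed

lemma forward_diff_funpow_mono:
  assumes "p_convex_on p {a..} f" "a \<le> u" "u \<le> v"
  shows "(forward_diff ^^ p) f u \<le> (forward_diff ^^ p) f v"
proof -
  have "dd_set f ((\<lambda>i. u + real i) ` {..p}) \<le> dd_set f ((\<lambda>i. v + real i) ` {..p})"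
    using assms by (intro dd_set_mono_nodes[OF assms(1)]) (auto simp: inj_on_def)
  then show ?thesis
    using dd_set_grid[of f _ p] by (simp add: grid_def lessThan_Suc_atMost divide_le_cancel)
qed

text \<open>
  Interpolation is exact at the nodes. The remainder formula, which needs a new node, still applies to
  the first \<open>k\<close> nodes, for which \<open>a + k\<close> is new; adding the term of index \<open>k\<close> then cancels the
  error, and the later terms vanish at \<open>x = k\<close>.
\<close>

lemma rho_at_node:
  assumes "k < n"
  shows "rho n a f (real k) = 0"
proof -
  have "real k \<notin> real ` {..<k}"
    by auto
  then have "rho k a f (real k) = (\<Prod>i<k. real k - real i) * dd_set f (grid a (Suc k))"
    by (simp add: rho_eq_newton_remainder grid_Suc)
  also have "(\<Prod>i<k. real k - real i) = fact k * (real k gchoose k)"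
    by (simp add: gbinomial_prod_rev lessThan_atLeast0)
  also have "real k gchoose k = 1"
    by (simp flip: binomial_gbinomial)
  finally have "rho (Suc k) a f (real k) = 0"
    by (simp add: rho_def dd_set_grid flip: binomial_gbinomial)
  moreover have "(\<Sum>j<n. (real k gchoose j) * (forward_diff ^^ j) f a)
      = (\<Sum>j<Suc k. (real k gchoose j) * (forward_diff ^^ j) f a)"
    using assms by (intro sum.mono_neutral_right) (auto simp flip: binomial_gbinomial)
  ultimately show ?thesis
    by (simp add: rho_def)
qed

text \<open>
  Both sides are compared through \<open>x\<close> times the divided difference \<open>?d\<close> on the nodes
  \<open>a, \<dots>, a + p, a + x\<close>: it is nonnegative by convexity, and one step of the recursion turns it
  into a difference of divided differences of order \<open>p\<close>, the larger of which only grows when its nodes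
  are moved up to \<open>a + x, \<dots>, a + x + p\<close>.
\<close>

lemma abs_rho_le:
  assumes convex: "p_convex_on p {a..} f" and "x > 0"
  shows "\<bar>rho (Suc p) a f x\<bar>
    \<le> \<bar>(x - 1) gchoose p\<bar> * ((forward_diff ^^ p) f (a + x) - (forward_diff ^^ p) f a)"
proof (cases "x \<in> real ` {..<Suc p}")
  case True
  then have "rho (Suc p) a f x = 0"
    using rho_at_node by auto
  moreover have "(forward_diff ^^ p) f a \<le> (forward_diff ^^ p) f (a + x)"
    using assms by (intro forward_diff_funpow_mono[OF convex]) auto
  ultimately show ?thesis by simp
next
  case False
  let ?X = "grid (a + 1) p"
  let ?d = "dd_set f (insert a (insert (a + x) ?X))"
  have x_ne: "x \<noteq> real i" if "i \<le> p" for i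
    using that False by auto
  have notin: "a \<notin> ?X" "a + x \<notin> ?X" "a \<noteq> a + x"
    using x_ne[of "Suc i" for i] \<open>x > 0\<close> by (auto simp: grid_def algebra_simps)
  have "x * ?d = dd_set f (insert (a + x) ?X) - dd_set f (grid a (Suc p))"
    using dd_set_recursion[OF finite_grid notin, of f] by (simp add: grid_Suc_left)
  moreover have "dd_set f (insert (a + x) ?X) \<le> dd_set f (grid (a + x) (Suc p))"
  proof -
    \<comment> \<open>Listing \<open>a + x\<close> first makes it stay in place, while \<open>a + i\<close> moves up to \<open>a + x + i\<close>.\<close>
    let ?s = "\<lambda>i. if i = 0 then a + x else a + real i"
    have "{..p} = insert 0 (Suc ` {..<p})"
      by (metis lessThan_Suc_atMost lessThan_Suc_eq_insert_0)
    then have "?s ` {..p} = insert (?s 0) ((\<lambda>i. ?s (Suc i)) ` {..<p})"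
      by (simp only: image_insert image_image)
    then have s: "?s ` {..p} = insert (a + x) ?X"
      by (simp add: grid_def algebra_simps)
    have "dd_set f (?s ` {..p}) \<le> dd_set f ((\<lambda>i. a + x + real i) ` {..p})"
      using \<open>x > 0\<close> x_ne by (intro dd_set_mono_nodes[OF convex]) (auto simp: inj_on_def split: if_splits)
    then show ?thesis
      unfolding s by (simp add: grid_def lessThan_Suc_atMost)
  qed
  ultimately have upper: "x * ?d \<le> ((forward_diff ^^ p) f (a + x) - (forward_diff ^^ p) f a) / fact p"
    by (simp add: dd_set_grid diff_divide_distrib)
  have "card (insert a (insert (a + x) ?X)) = p + 2"
    using notin by (simp add: grid_def card_image inj_on_def)
  moreover have "insert a (insert (a + x) ?X) \<subseteq> {a..}"
    using \<open>x > 0\<close> by (auto simp: grid_def)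
  ultimately have "0 \<le> x * ?d"
    using convex \<open>x > 0\<close> by (simp add: p_convex_on_iff_dd_set)
  have prod: "(\<Prod>i<Suc p. x - real i) = x * (fact p * ((x - 1) gchoose p))"
    by (subst prod.lessThan_Suc_shift) (simp add: gbinomial_prod_rev lessThan_atLeast0 algebra_simps)
  have "rho (Suc p) a f x = (\<Prod>i<Suc p. x - real i) * ?d"
    using rho_eq_newton_remainder[OF False, of a f] by (simp add: grid_Suc_left insert_commute)
  also have "\<dots> = ((x - 1) gchoose p) * (fact p * (x * ?d))"
    unfolding prod by simp
  finally have "\<bar>rho (Suc p) a f x\<bar> = \<bar>(x - 1) gchoose p\<bar> * (fact p * (x * ?d))"
    using abs_of_nonneg[OF \<open>0 \<le> x * ?d\<close>] by (simp add: abs_mult)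
  also have "\<dots> \<le> \<bar>(x - 1) gchoose p\<bar> * ((forward_diff ^^ p) f (a + x) - (forward_diff ^^ p) f a)"
    using upper by (intro mult_left_mono) (auto simp: field_simps)
  finally show ?thesis .
qed

text \<open>
  With an integer shift, the right-hand side telescopes when summed over integers \<open>a\<close>, and it tends to
  \<open>0\<close> also when \<open>a\<close> runs through the natural numbers only.
\<close>

lemma abs_rho_le_ceiling:
  assumes convex: "p_convex_on p {a..} f" and "x > 0"
  shows "\<bar>rho (Suc p) a f x\<bar>
    \<le> \<bar>(x - 1) gchoose p\<bar> * ((forward_diff ^^ p) f (a + real (nat \<lceil>x\<rceil>)) - (forward_diff ^^ p) f a)"
proof -
  have "x \<le> real (nat \<lceil>x\<rceil>)"
    by linarith
  then have "(forward_diff ^^ p) f (a + x) \<le> (forward_diff ^^ p) f (a + real (nat \<lceil>x\<rceil>))"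
    using \<open>x > 0\<close> by (intro forward_diff_funpow_mono[OF convex]) auto
  with abs_rho_le[OF assms] show ?thesis
    by (smt (verit) mult_left_mono abs_ge_zero)
qed

section \<open>Convergence\<close>

lemma f_seq_Suc:
  assumes "n \<ge> 1"
  shows "f_seq p g (Suc n) x - f_seq p g n x = - rho (Suc p) (real n) g x"
proof -
  have D: "(forward_diff ^^ (j - 1)) g (real (Suc n)) - (forward_diff ^^ (j - 1)) g (real n)
      = (forward_diff ^^ j) g (real n)" if "j \<ge> 1" for j
    using that by (cases j) (auto simp: forward_diff_def add.commute)
  have "f_seq p g (Suc n) x - f_seq p g n x = g (real n) - g (x + real n) + 
      (\<Sum>j=1..p. (x gchoose j) *
        ((forward_diff ^^ (j - 1)) g (real (Suc n)) - (forward_diff ^^ (j - 1)) g (real n)))"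
    using assms by (simp add: f_seq_def sum_subtractf right_diff_distrib)
  also have "(\<Sum>j=1..p. (x gchoose j) *
        ((forward_diff ^^ (j - 1)) g (real (Suc n)) - (forward_diff ^^ (j - 1)) g (real n)))
      = (\<Sum>j=1..p. (x gchoose j) * (forward_diff ^^ j) g (real n))"
    using D by (intro sum.cong) auto
  also have "(\<Sum>j<Suc p. (x gchoose j) * (forward_diff ^^ j) g (real n))
      = g (real n) + (\<Sum>j=1..p. (x gchoose j) * (forward_diff ^^ j) g (real n))"
    by (simp add: lessThan_Suc_atMost atMost_atLeast0 sum.atLeast_Suc_atMost)
  ultimately show ?thesis
    by (simp add: rho_def)
qed

text \<open>
  A Cauchy estimate. Summed over \<open>k\<close> from \<open>n\<close> to \<open>N - 1\<close>, the bounds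
  \<open>D (k + m) - D k\<close>, where \<open>D = \<Delta>\<^sup>p g\<close> and \<open>m = \<lceil>x\<rceil>\<close>, collapse to
  \<open>\<Sum>i<m. D (N + i) - D (n + i)\<close>. Being nondecreasing with limit \<open>0\<close>, \<open>D\<close> is nonpositive, so each of
  these \<open>m\<close> terms is at most \<open>- D n\<close>.
\<close>

lemma abs_f_seq_diff_le:
  assumes convex: "p_convex_on p {real n..} g"
    and lim: "(\<lambda>k. (forward_diff ^^ p) g (real k)) \<longlonglongrightarrow> 0"
    and "n \<ge> 1" "n \<le> N" "x > 0"
  shows "\<bar>f_seq p g N x - f_seq p g n x\<bar>
    \<le> of_int \<lceil>x\<rceil> * \<bar>(x - 1) gchoose p\<bar> * \<bar>(forward_diff ^^ p) g (real n)\<bar>"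
proof -
  define D where "D k = (forward_diff ^^ p) g (real k)" for k
  define m where "m = nat \<lceil>x\<rceil>"
  let ?c = "\<bar>(x - 1) gchoose p\<bar>"
  have mono: "D k \<le> D l" if "n \<le> k" "k \<le> l" for k l
    using that forward_diff_funpow_mono[OF convex] by (simp add: D_def)
  have nonpos: "D k \<le> 0" if "n \<le> k" for k
    using that mono lim by (intro LIMSEQ_le_const[of D]) (auto simp flip: D_def)
  have rho_le: "\<bar>rho (Suc p) (real k) g x\<bar> \<le> ?c * (D (k + m) - D k)" if "n \<le> k" for k
    using abs_rho_le_ceiling[OF p_convex_on_subset[OF convex], of "real k" x] that \<open>x > 0\<close>
    by (simp add: D_def m_def)
  have "\<bar>f_seq p g N x - f_seq p g n x\<bar> \<le> ?c * (\<Sum>i<m. D (N + i) - D (n + i))"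
    using \<open>n \<le> N\<close>
  proof (induction N rule: dec_induct)
    case base
    then show ?case by simp
  next
    case (step N)
    have "D (N + m) - D N = (\<Sum>i<m. D (Suc N + i) - D (N + i))"
      using sum_lessThan_telescope[of "\<lambda>i. D (N + i)" m] by simp
    then have "(\<Sum>i<m. D (Suc N + i) - D (n + i)) = (\<Sum>i<m. D (N + i) - D (n + i)) + (D (N + m) - D N)"
      by (simp flip: sum.distrib)
    then have "?c * (\<Sum>i<m. D (Suc N + i) - D (n + i))
        = ?c * (\<Sum>i<m. D (N + i) - D (n + i)) + ?c * (D (N + m) - D N)"
      by (simp only: distrib_left)
    moreover have "\<bar>f_seq p g (Suc N) x - f_seq p g N x\<bar> \<le> ?c * (D (N + m) - D N)"
      using f_seq_Suc[of N p g x] rho_le[of N] step \<open>n \<ge> 1\<close> by simp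
    ultimately show ?case
      using step.IH by linarith
  qed
  also have "\<dots> \<le> ?c * (\<Sum>i<m. \<bar>D n\<bar>)"
  proof (intro mult_left_mono sum_mono)
    fix i
    show "D (N + i) - D (n + i) \<le> \<bar>D n\<bar>"
      using nonpos[of "N + i"] nonpos[of n] mono[of n "n + i"] \<open>n \<le> N\<close> by simp
  qed simp
  also have "\<dots> = of_int \<lceil>x\<rceil> * ?c * \<bar>D n\<bar>"
    using \<open>x > 0\<close> by (simp add: m_def)
  finally show ?thesis
    by (simp add: D_def)
qed

section \<open>Passing to the negative function, and restricted limits\<close>

lemma forward_diff_funpow_minus:
  "(forward_diff ^^ j) (\<lambda>x. - g x) u = - (forward_diff ^^ j) g u"
  by (induction j arbitrary: u) (simp_all add: forward_diff_def)

lemma f_seq_minus: "f_seq p (\<lambda>x. - g x) n x = - f_seq p g n x"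
  by (simp add: f_seq_def forward_diff_funpow_minus sum_negf sum_subtractf)

lemma rho_minus: "rho p a (\<lambda>x. - g x) x = - rho p a g x"
  by (simp add: rho_def forward_diff_funpow_minus sum_negf)

lemma D_class_minus: "g \<in> D_class p S \<Longrightarrow> (\<lambda>x. - g x) \<in> D_class p S"
proof -
  have "(forward_diff ^^ p) (\<lambda>x. - g x) = (\<lambda>u. - (forward_diff ^^ p) g u)"
    by (rule ext) (rule forward_diff_funpow_minus)
  then show "g \<in> D_class p S \<Longrightarrow> (\<lambda>x. - g x) \<in> D_class p S"
    using tendsto_minus[of "(forward_diff ^^ p) g" 0] by (simp add: D_class_def)
qed

lemma D_K_class_minus:
  assumes "g \<in> D_class p S \<inter> K_class p"
  shows "(\<lambda>x. - g x) \<in> D_class p S \<inter> K_class p"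
  using assms D_class_minus by (auto simp: K_class_def p_concave_on_iff_minus)

lemma filterlim_real_at_top_in:
  assumes "S \<in> {\<nat>, \<real>}"
  shows "filterlim real (at_top_in S) sequentially"
  using assms unfolding at_top_in_def filterlim_inf filterlim_principal
  by (auto intro!: filterlim_real_sequentially eventuallyI simp: Reals_def)

lemma filterlim_add_nat_at_top_in:
  assumes "S \<in> {\<nat>, \<real>}"
  shows "filterlim (\<lambda>a. a + real m) (at_top_in S) (at_top_in S)"
proof -
  have "filterlim (\<lambda>a::real. a + real m) at_top at_top"
    using filterlim_tendsto_add_at_top[OF tendsto_const filterlim_ident]
    by (subst add.commute)
  then have "filterlim (\<lambda>a::real. a + real m) at_top (at_top_in S)"
    unfolding at_top_in_def by (rule filterlim_mono) auto
  moreover have "\<forall>\<^sub>F a in at_top_in S. a + real m \<in> S"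
    using assms by (auto simp: at_top_in_def eventually_inf_principal Reals_def intro!: eventuallyI)
  ultimately have "filterlim (\<lambda>a. a + real m) (inf at_top (principal S)) (at_top_in S)"
    by (simp only: filterlim_inf filterlim_principal)
  then show ?thesis
    by (simp only: at_top_in_def)
qed

section \<open>The limit function and its difference equation\<close>

text \<open>
  Since \<open>rho p t g x\<close> differs from \<open>rho (Suc p) t g x\<close> by a multiple of \<open>\<Delta>\<^sup>p g t\<close>, it is enough to treat
  the latter. The shift by \<open>\<lceil>x\<rceil>\<close> rather than \<open>x\<close> keeps \<open>t\<close> inside \<open>S\<close>.
\<close>

lemma rho_tendsto_0_if_convex:
  assumes S: "S \<in> {\<nat>, \<real>}" and D: "g \<in> D_class p S"
    and convex: "p_convex_on p {a..} g" and "x > 0"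
  shows "((\<lambda>t. rho p t g x) \<longlongrightarrow> 0) (at_top_in S)"
proof -
  let ?D = "(forward_diff ^^ p) g"
  let ?m = "nat \<lceil>x\<rceil>"
  have lim: "(?D \<longlongrightarrow> 0) (at_top_in S)"
    using D by (simp add: D_class_def)
  have lim_shift: "((\<lambda>t. ?D (t + real ?m)) \<longlongrightarrow> 0) (at_top_in S)"
    using lim filterlim_add_nat_at_top_in[OF S] by (rule filterlim_compose)
  have "\<forall>\<^sub>F t in at_top_in S. t \<ge> a"
    unfolding at_top_in_def by (rule filter_leD[OF inf_le1 eventually_ge_at_top])
  then have "\<forall>\<^sub>F t in at_top_in S.
      norm (rho (Suc p) t g x) \<le> \<bar>(x - 1) gchoose p\<bar> * (?D (t + real ?m) - ?D t)"
  proof eventually_elim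
    case (elim t)
    then have "p_convex_on p {t..} g"
      by (intro p_convex_on_subset[OF convex]) auto
    then show ?case
      using abs_rho_le_ceiling \<open>x > 0\<close> by simp
  qed
  moreover have "((\<lambda>t. \<bar>(x - 1) gchoose p\<bar> * (?D (t + real ?m) - ?D t)) \<longlongrightarrow> 0) (at_top_in S)"
    by (auto intro!: tendsto_eq_intros lim lim_shift)
  ultimately have "((\<lambda>t. rho (Suc p) t g x) \<longlongrightarrow> 0) (at_top_in S)"
    by (rule Lim_null_comparison)
  then have "((\<lambda>t. rho (Suc p) t g x + (x gchoose p) * ?D t) \<longlongrightarrow> 0) (at_top_in S)"
    by (auto intro!: tendsto_eq_intros lim)
  then show ?thesis
    by (simp add: rho_def)
qed

lemma D_class_sequence:
  assumes "S \<in> {\<nat>, \<real>}" "g \<in> D_class p S"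
  shows "(\<lambda>k. (forward_diff ^^ p) g (real k)) \<longlonglongrightarrow> 0"
  using assms filterlim_compose[OF _ filterlim_real_at_top_in] by (auto simp: D_class_def)

lemma convergent_f_seq_if_convex:
  assumes convex: "p_convex_on p {a..} g"
    and lim: "(\<lambda>k. (forward_diff ^^ p) g (real k)) \<longlonglongrightarrow> 0"
    and "x > 0"
  shows "convergent (\<lambda>n. f_seq p g n x)"
proof -
  let ?C = "of_int \<lceil>x\<rceil> * \<bar>(x - 1) gchoose p\<bar>"
  define n0 where "n0 = max 1 (nat \<lceil>a\<rceil>)"
  have bound: "\<bar>f_seq p g N x - f_seq p g n x\<bar> \<le> ?C * \<bar>(forward_diff ^^ p) g (real n)\<bar>"
    if "n \<ge> n0" "N \<ge> n" for n N
  proof (rule abs_f_seq_diff_le)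
    have "a \<le> real n"
      using that by (simp add: n0_def)
    then show "p_convex_on p {real n..} g"
      by (intro p_convex_on_subset[OF convex]) auto
  qed (use that lim \<open>x > 0\<close> in \<open>auto simp: n0_def\<close>)
  have "(\<lambda>n. ?C * \<bar>(forward_diff ^^ p) g (real n)\<bar>) \<longlonglongrightarrow> 0"
    by (auto intro!: tendsto_eq_intros lim)
  then have "Cauchy (\<lambda>n. f_seq p g n x)"
    unfolding Cauchy_altdef2
  proof (intro allI impI)
    fix e :: real assume "e > 0"
    then have "\<forall>\<^sub>F n in sequentially. ?C * \<bar>(forward_diff ^^ p) g (real n)\<bar> < e \<and> n0 \<le> n"
      using \<open>(\<lambda>n. ?C * \<bar>(forward_diff ^^ p) g (real n)\<bar>) \<longlonglongrightarrow> 0\<close>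
      by (intro eventually_conj order_tendstoD eventually_ge_at_top) auto
    then obtain M where M: "?C * \<bar>(forward_diff ^^ p) g (real M)\<bar> < e" "n0 \<le> M"
      by (auto simp: eventually_sequentially)
    then show "\<exists>N. \<forall>n\<ge>N. dist (f_seq p g n x) (f_seq p g N x) < e"
      using bound[of M] by (intro exI[of _ M]) (force simp: dist_real_def intro: le_less_trans)
  qed
  then show ?thesis
    by (simp add: Cauchy_convergent_iff)
qed

lemma f_seq_tendsto_f_lim:
  assumes "S \<in> {\<nat>, \<real>}" "g \<in> D_class p S \<inter> K_class p" "x > 0"
  shows "(\<lambda>n. f_seq p g n x) \<longlonglongrightarrow> f_lim p g x"
proof -
  consider a where "p_convex_on p {a..} g" | a where "p_concave_on p {a..} g"
    using assms(2) by (auto simp: K_class_def)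
  then have "convergent (\<lambda>n. f_seq p g n x)"
  proof cases
    case 1
    then show ?thesis
      using assms D_class_sequence by (intro convergent_f_seq_if_convex) auto
  next
    case (2 a)
    have "convergent (\<lambda>n. f_seq p (\<lambda>x. - g x) n x)"
      using assms 2 D_class_sequence D_class_minus
      by (intro convergent_f_seq_if_convex[of p a]) (auto simp: p_concave_on_iff_minus)
    then show ?thesis
      by (simp add: f_seq_minus convergent_minus_iff[symmetric])
  qed
  then show ?thesis
    by (simp add: f_lim_def convergent_LIMSEQ_iff)
qed

lemma f_lim_minus:
  assumes "S \<in> {\<nat>, \<real>}" "g \<in> D_class p S \<inter> K_class p" "x > 0"
  shows "f_lim p (\<lambda>x. - g x) x = - f_lim p g x"
  unfolding f_lim_def f_seq_minus
  by (rule limI) (rule tendsto_minus[OF f_seq_tendsto_f_lim[OF assms, unfolded f_lim_def]])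

lemma subset_R_class:
  assumes "S \<in> {\<nat>, \<real>}" "g \<in> D_class p S \<inter> K_class p"
  shows "g \<in> R_class p S"
  unfolding R_class_def
proof (intro CollectI allI impI)
  fix x :: real assume "x > 0"
  consider a where "p_convex_on p {a..} g" | a where "p_concave_on p {a..} g"
    using assms(2) by (auto simp: K_class_def)
  then show "((\<lambda>a. rho p a g x) \<longlongrightarrow> 0) (at_top_in S)"
  proof cases
    case 1
    then show ?thesis
      using assms \<open>x > 0\<close> by (intro rho_tendsto_0_if_convex) auto
  next
    case (2 a)
    have "((\<lambda>a. rho p a (\<lambda>x. - g x) x) \<longlongrightarrow> 0) (at_top_in S)"
      using assms 2 \<open>x > 0\<close> D_class_minus
      by (intro rho_tendsto_0_if_convex[of S _ p a]) (auto simp: p_concave_on_iff_minus)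
    then show ?thesis
      by (simp add: rho_minus tendsto_minus_cancel_left[symmetric])
  qed
qed

text \<open>
  The sum in \<open>f_seq\<close> telescopes, and Pascal's rule lowers the binomial coefficients, which leaves
  precisely the terms of \<open>rho p n g x\<close>.
\<close>

lemma f_seq_forward_diff:
  assumes "n \<ge> 1"
  shows "f_seq p g n (x + 1) - f_seq p g n x = g x - rho p (real n) g x"
proof -
  have "f_seq p g n (x + 1) - f_seq p g n x = 
      g x - g (x + 1) + (\<Sum>k\<in>{1..<n}. g (x + real k) - g (x + real (Suc k)))
      + (\<Sum>j=1..p. ((x + 1 gchoose j) - (x gchoose j)) * (forward_diff ^^ (j - 1)) g (real n))"
    by (simp add: f_seq_def sum_subtractf left_diff_distrib add.assoc)
  also have "(\<Sum>k\<in>{1..<n}. g (x + real k) - g (x + real (Suc k))) = g (x + 1) - g (x + real n)"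
    using sum_Suc_diff'[of 1 n "\<lambda>k. - g (x + real k)"] assms by simp
  also have "(\<Sum>j=1..p. ((x + 1 gchoose j) - (x gchoose j)) * (forward_diff ^^ (j - 1)) g (real n))
      = (\<Sum>j<p. (x gchoose j) * (forward_diff ^^ j) g (real n))"
    using gbinomial_Suc_Suc[of x]
    by (intro sum.reindex_bij_witness[of _ Suc "\<lambda>j. j - 1"]) (auto simp: gr0_conv_Suc Suc_le_eq)
  finally show ?thesis
    by (simp add: rho_def)
qed

lemma forward_diff_f_lim:
  assumes "S \<in> {\<nat>, \<real>}" "g \<in> D_class p S \<inter> K_class p" "x > 0"
  shows "forward_diff (f_lim p g) x = g x"
proof -
  have "((\<lambda>a. rho p a g x) \<longlongrightarrow> 0) (at_top_in S)"
    using subset_R_class[OF assms(1,2)] assms(3) by (auto simp: R_class_def)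
  then have "(\<lambda>n. rho p (real n) g x) \<longlonglongrightarrow> 0"
    using filterlim_real_at_top_in[OF assms(1)] by (rule filterlim_compose)
  then have "(\<lambda>n. g x - rho p (real n) g x) \<longlonglongrightarrow> g x"
    by (auto intro!: tendsto_eq_intros)
  moreover have "\<forall>\<^sub>F n in sequentially. g x - rho p (real n) g x = f_seq p g n (x + 1) - f_seq p g n x"
    using eventually_ge_at_top[of 1] by eventually_elim (simp add: f_seq_forward_diff)
  ultimately have "(\<lambda>n. f_seq p g n (x + 1) - f_seq p g n x) \<longlonglongrightarrow> g x"
    by (rule Lim_transform_eventually)
  moreover have "(\<lambda>n. f_seq p g n (x + 1) - f_seq p g n x) \<longlonglongrightarrow> f_lim p g (x + 1) - f_lim p g x"
    using assms by (intro tendsto_diff f_seq_tendsto_f_lim) auto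
  ultimately show ?thesis
    unfolding forward_diff_def using LIMSEQ_unique by blast
qed

lemma f_lim_1:
  assumes "S \<in> {\<nat>, \<real>}" "g \<in> D_class p S \<inter> K_class p"
  shows "f_lim p g 1 = 0"
proof -
  have "\<forall>\<^sub>F n in sequentially. (if p = 0 then - g (real n) else 0) = f_seq p g n 1"
    using eventually_ge_at_top[of 1]
  proof eventually_elim
    case (elim n)
    have "(\<Sum>k\<in>{1..<n}. g (real k) - g (1 + real k)) = g 1 - g (real n)"
      using sum_Suc_diff'[of 1 n "\<lambda>k. - g (real k)"] elim by simp
    moreover have "(\<Sum>j=1..p. (1 gchoose j) * (forward_diff ^^ (j - 1)) g (real n))
        = (if p = 0 then 0 else g (real n))"
    proof (cases "p = 0")
      case False
      have "(1::real) gchoose j = 0" if "j > 1" for j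
        using that binomial_gbinomial[of 1 j, where 'a = real] by (simp add: binomial_eq_0)
      then have "(\<Sum>j=1..p. (1 gchoose j) * (forward_diff ^^ (j - 1)) g (real n))
          = (\<Sum>j\<in>{1}. (1 gchoose j) * (forward_diff ^^ (j - 1)) g (real n))"
        using False by (intro sum.mono_neutral_right) auto
      then show ?thesis
        using False by simp
    qed simp
    ultimately show ?case
      by (simp add: f_seq_def)
  qed
  moreover have "(\<lambda>n. if p = 0 then - g (real n) else 0) \<longlonglongrightarrow> 0"
    using D_class_sequence[of S g p] tendsto_minus[of "\<lambda>n. g (real n)" 0] assms
    by (cases "p = 0") auto
  ultimately have "(\<lambda>n. f_seq p g n 1) \<longlonglongrightarrow> 0"
    by (rule Lim_transform_eventually[rotated])
  with f_seq_tendsto_f_lim[OF assms, of 1] show ?thesis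
    using LIMSEQ_unique by force
qed

section \<open>Convexity of the limit\<close>

lemma unbounded_pos_interval_upward_closed:
  assumes "unbounded_pos_interval I" "x \<in> I" "x \<le> y"
  shows "y \<in> I"
proof -
  have "I \<subseteq> {0<..}" "\<not> bounded I" "is_interval I"
    using assms by (auto simp: unbounded_pos_interval_def)
  have "\<exists>z\<in>I. y \<le> z"
  proof (rule ccontr)
    assume "\<not> ?thesis"
    then have "I \<subseteq> {0..y}"
      using \<open>I \<subseteq> {0<..}\<close> by force
    then show False
      using \<open>\<not> bounded I\<close> bounded_subset bounded_closed_interval by blast
  qed
  then show ?thesis
    using \<open>is_interval I\<close> assms by (meson is_interval_1)
qed

text \<open>
  As a function of \<open>x\<close>, \<open>f_seq p g n\<close> is minus a sum of translates of \<open>g\<close> plus a polynomial of degree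
  at most \<open>p\<close>, which the divided difference does not see.
\<close>

lemma dd_set_f_seq:
  assumes "finite X" "card X = p + 2" "n \<ge> 1"
  shows "dd_set (f_seq p g n) X = - (\<Sum>k<n. dd_set g ((\<lambda>x. x + real k) ` X))"
proof -
  define c where "c = (\<Sum>k\<in>{1..<n}. g (real k))"
  have "{..<n} = insert 0 {1..<n}"
    using assms by auto
  \<comment> \<open>The constant is written \<open>c * 1\<close> for linearity to reduce it to \<open>dd_set_one\<close>.\<close>
  then have "f_seq p g n = (\<lambda>x. ((\<Sum>k<n. - g (x + real k)) + c * 1)
      + (\<Sum>j=1..p. (forward_diff ^^ (j - 1)) g (real n) * (x gchoose j)))"
    by (intro ext) (simp add: f_seq_def c_def sum_subtractf sum_negf mult.commute)
  then show ?thesis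
    using assms
    by (simp only: dd_set_add dd_set_sum dd_set_mult_left dd_set_minus dd_set_one dd_set_shift)
      (simp add: dd_set_gchoose sum_negf)
qed

lemma p_concave_on_f_lim:
  assumes "S \<in> {\<nat>, \<real>}" "g \<in> D_class p S \<inter> K_class p"
    and I: "unbounded_pos_interval I" and convex: "p_convex_on p I g"
  shows "p_concave_on p I (f_lim p g)"
  unfolding p_concave_on_iff_minus p_convex_on_iff_dd_set dd_set_minus
proof (intro allI impI)
  fix X assume X: "X \<subseteq> I" "finite X \<and> card X = p + 2"
  have "x > 0" if "x \<in> X" for x
    using that X I by (auto simp: unbounded_pos_interval_def)
  then have "(\<lambda>n. dd_set (f_seq p g n) X) \<longlonglongrightarrow> dd_set (f_lim p g) X"
    unfolding dd_set_def using X
    by (intro tendsto_sum tendsto_divide tendsto_const f_seq_tendsto_f_lim[OF assms(1,2)]) auto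
  moreover have "dd_set (f_seq p g n) X \<le> 0" if "n \<ge> 1" for n
  proof -
    have "0 \<le> dd_set g ((\<lambda>x. x + real k) ` X)" for k
      using convex X unbounded_pos_interval_upward_closed[OF I]
      by (intro convex[unfolded p_convex_on_iff_dd_set, rule_format])
        (auto simp: card_image inj_on_def)
    then show ?thesis
      using X that by (simp add: dd_set_f_seq sum_nonneg)
  qed
  ultimately have "dd_set (f_lim p g) X \<le> 0"
    by (intro LIMSEQ_le_const2) auto
  then show "0 \<le> - dd_set (f_lim p g) X"
    by simp
qed

lemma p_convex_on_f_lim:
  assumes S: "S \<in> {\<nat>, \<real>}" and g: "g \<in> D_class p S \<inter> K_class p"
    and I: "unbounded_pos_interval I" and concave: "p_concave_on p I g"
  shows "p_convex_on p I (f_lim p g)"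
proof -
  have "p_concave_on p I (f_lim p (\<lambda>x. - g x))"
    using concave p_concave_on_f_lim[OF S D_K_class_minus[OF g] I] by (simp add: p_concave_on_iff_minus)
  then have "p_convex_on p I (\<lambda>x. - f_lim p (\<lambda>x. - g x) x)"
    by (simp add: p_concave_on_iff_minus)
  moreover have "- f_lim p (\<lambda>x. - g x) x = f_lim p g x" if "x \<in> I" for x
    using that I f_lim_minus[OF S g, of x] by (auto simp: unbounded_pos_interval_def)
  then have "dd_set (\<lambda>x. - f_lim p (\<lambda>x. - g x) x) X = dd_set (f_lim p g) X" if "X \<subseteq> I" for X
    unfolding dd_set_def using that by (intro sum.cong refl) (metis subsetD)
  ultimately show ?thesis
    by (simp add: p_convex_on_iff_dd_set)
qed

section \<open>Error bounds and uniform convergence\<close>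

lemma abs_f_seq_minus_f_lim_le:
  assumes S: "S \<in> {\<nat>, \<real>}" and g: "g \<in> D_class p S \<inter> K_class p"
    and shape: "p_convex_on p {real n..} g \<or> p_concave_on p {real n..} g"
    and "n \<ge> 1" "x > 0"
  shows "\<bar>f_seq p g n x - f_lim p g x\<bar>
    \<le> of_int \<lceil>x\<rceil> * \<bar>(x - 1) gchoose p\<bar> * \<bar>(forward_diff ^^ p) g (real n)\<bar>"
proof -
  have convex_case: "\<bar>f_seq p h n x - f_lim p h x\<bar>
    \<le> of_int \<lceil>x\<rceil> * \<bar>(x - 1) gchoose p\<bar> * \<bar>(forward_diff ^^ p) h (real n)\<bar>"
    if h: "h \<in> D_class p S \<inter> K_class p" and convex: "p_convex_on p {real n..} h" for h
  proof -
    let ?B = "of_int \<lceil>x\<rceil> * \<bar>(x - 1) gchoose p\<bar> * \<bar>(forward_diff ^^ p) h (real n)\<bar>"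
    have "(\<lambda>N. \<bar>f_seq p h N x - f_seq p h n x\<bar>) \<longlonglongrightarrow> \<bar>f_lim p h x - f_seq p h n x\<bar>"
      by (intro tendsto_intros f_seq_tendsto_f_lim[OF S h \<open>x > 0\<close>])
    moreover have "\<bar>f_seq p h N x - f_seq p h n x\<bar> \<le> ?B" if "N \<ge> n" for N
      using D_class_sequence[OF S] h convex that \<open>n \<ge> 1\<close> \<open>x > 0\<close>
      by (intro abs_f_seq_diff_le) auto
    ultimately have "\<bar>f_lim p h x - f_seq p h n x\<bar> \<le> ?B"
      by (intro LIMSEQ_le_const2) auto
    then show ?thesis
      by (simp only: abs_minus_commute)
  qed
  show ?thesis
    using shape
  proof
    assume "p_concave_on p {real n..} g"
    then show ?thesis
      using convex_case[OF D_K_class_minus[OF g]]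
      by (simp add: p_concave_on_iff_minus f_seq_minus f_lim_minus[OF S g \<open>x > 0\<close>]
          forward_diff_funpow_minus abs_minus_commute)
  qed (rule convex_case[OF g])
qed

lemma forward_diff_funpow_cong:
  assumes "\<And>y. y > 0 \<Longrightarrow> f y = h y" "u > 0"
  shows "(forward_diff ^^ j) f u = (forward_diff ^^ j) h u"
  using assms(2)
proof (induction j arbitrary: u)
  case (Suc j)
  then show ?case
    using Suc.IH[of u] Suc.IH[of "u + 1"] by (simp add: forward_diff_def[of "(forward_diff ^^ j) _"])
qed (use assms(1) in simp)

lemma forward_diff_funpow_Suc_antidifference:
  assumes "\<And>y. y > 0 \<Longrightarrow> forward_diff f y = g y" "u > 0"
  shows "(forward_diff ^^ Suc j) f u = (forward_diff ^^ j) g u"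
  unfolding funpow_Suc_right comp_apply by (rule forward_diff_funpow_cong[OF assms])

text \<open>
  Writing \<open>g\<close> as \<open>\<Delta> f\<close> makes the sum in \<open>f_seq\<close> telescope and turns \<open>\<Delta>\<^sup>j\<^sup>-\<^sup>1 g\<close> into \<open>\<Delta>\<^sup>j f\<close>: the
  distance of \<open>f_seq p g n\<close> to its limit is itself an interpolation error, that of the limit.
\<close>

lemma f_seq_eq_antidifference_minus_rho:
  assumes f: "\<And>y. y > 0 \<Longrightarrow> forward_diff f y = g y" and "f 1 = 0" "n \<ge> 1" "x > 0"
  shows "f_seq p g n x = f x - rho (Suc p) (real n) f x"
proof -
  have "g (real k) - g (x + real k) =
      (f (real (Suc k)) - f (x + real (Suc k))) - (f (real k) - f (x + real k))" if "k \<ge> 1" for k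
    using that \<open>x > 0\<close> f[of "real k"] f[of "x + real k"] by (simp add: forward_diff_def add_ac)
  then have "(\<Sum>k\<in>{1..<n}. g (real k) - g (x + real k)) =
     (\<Sum>k\<in>{1..<n}. (f (real (Suc k)) - f (x + real (Suc k))) - (f (real k) - f (x + real k)))"
    by (intro sum.cong) auto
  also have "\<dots> = (f (real n) - f (x + real n)) - (f 1 - f (x + 1))"
    using sum_Suc_diff'[of 1 n "\<lambda>k. f (real k) - f (x + real k)"] \<open>n \<ge> 1\<close> by simp
  moreover have "(\<Sum>j<Suc p. (x gchoose j) * (forward_diff ^^ j) f (real n))
      = f (real n) + (\<Sum>j=1..p. (x gchoose j) * (forward_diff ^^ j) f (real n))"
    by (simp add: lessThan_Suc_atMost atMost_atLeast0 sum.atLeast_Suc_atMost)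
  moreover have "(\<Sum>j=1..p. (x gchoose j) * (forward_diff ^^ j) f (real n))
      = (\<Sum>j=1..p. (x gchoose j) * (forward_diff ^^ (j - 1)) g (real n))"
  proof (intro sum.cong refl)
    fix j assume "j \<in> {1..p}"
    then show "(x gchoose j) * (forward_diff ^^ j) f (real n)
        = (x gchoose j) * (forward_diff ^^ (j - 1)) g (real n)"
      using forward_diff_funpow_Suc_antidifference[of f g "real n" "j - 1", OF f] \<open>n \<ge> 1\<close> by simp
  qed
  ultimately show ?thesis
    using f[OF \<open>x > 0\<close>] \<open>f 1 = 0\<close> by (simp add: f_seq_def rho_def forward_diff_def)
qed

lemma abs_f_seq_minus_f_lim_le_tight:
  assumes S: "S \<in> {\<nat>, \<real>}" and g: "g \<in> D_class p S \<inter> K_class p"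
    and shape: "p_convex_on p {real n..} (f_lim p g) \<or> p_concave_on p {real n..} (f_lim p g)"
    and "p \<ge> 1" "n \<ge> 1" "x > 0"
  shows "\<bar>f_seq p g n x - f_lim p g x\<bar> \<le> \<bar>(x - 1) gchoose p\<bar> *
      \<bar>(forward_diff ^^ (p - 1)) g (real n + x) - (forward_diff ^^ (p - 1)) g (real n)\<bar>"
proof -
  let ?f = "f_lim p g"
  have "\<bar>rho (Suc p) (real n) ?f x\<bar>
      \<le> \<bar>(x - 1) gchoose p\<bar> * \<bar>(forward_diff ^^ p) ?f (real n + x) - (forward_diff ^^ p) ?f (real n)\<bar>"
    using shape
  proof
    assume "p_convex_on p {real n..} ?f"
    from abs_rho_le[OF this \<open>x > 0\<close>] show ?thesis
      by (rule order_trans) (intro mult_left_mono; simp)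
  next
    assume "p_concave_on p {real n..} ?f"
    then have "p_convex_on p {real n..} (\<lambda>x. - ?f x)"
      by (simp add: p_concave_on_iff_minus)
    from abs_rho_le[OF this \<open>x > 0\<close>] show ?thesis
      unfolding rho_minus forward_diff_funpow_minus abs_minus_cancel
      by (rule order_trans) (intro mult_left_mono; simp)
  qed
  moreover have "(forward_diff ^^ p) ?f u = (forward_diff ^^ (p - 1)) g u" if "u > 0" for u
    using forward_diff_funpow_Suc_antidifference[of ?f g u "p - 1", OF forward_diff_f_lim[OF S g] that]
      \<open>p \<ge> 1\<close> by simp
  moreover have "f_seq p g n x - ?f x = - rho (Suc p) (real n) ?f x"
    using f_seq_eq_antidifference_minus_rho[of ?f g n x p, OF forward_diff_f_lim[OF S g] f_lim_1[OF S g]]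
      assms by simp
  ultimately show ?thesis
    using \<open>n \<ge> 1\<close> \<open>x > 0\<close> by simp
qed

text \<open>
  The error bound is a locally bounded function of \<open>x\<close> times \<open>\<bar>\<Delta>\<^sup>p g n\<bar>\<close>.
\<close>

lemma uniform_limit_f_seq:
  assumes S: "S \<in> {\<nat>, \<real>}" and g: "g \<in> D_class p S \<inter> K_class p"
    and A: "A \<subseteq> {0<..}" "bounded A"
  shows "uniform_limit A (f_seq p g) (f_lim p g) sequentially"
proof -
  let ?D = "\<lambda>n. (forward_diff ^^ p) g (real n)"
  obtain a where a: "p_convex_on p {a..} g \<or> p_concave_on p {a..} g"
    using g by (auto simp: K_class_def)
  obtain B where B: "\<And>x. x \<in> A \<Longrightarrow> x \<le> B"
    using A(2) by (auto simp: bounded_iff dest: abs_le_D1)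
  have "continuous_on {0..B} (\<lambda>x. (x - 1) gchoose p)"
    unfolding gbinomial_prod_rev by (intro continuous_intros) auto
  then have "bounded ((\<lambda>x. (x - 1) gchoose p) ` {0..B})"
    by (intro compact_imp_bounded compact_continuous_image) auto
  then obtain C where C: "\<And>x. x \<in> {0..B} \<Longrightarrow> \<bar>(x - 1) gchoose p\<bar> \<le> C"
    unfolding bounded_iff by (metis imageI real_norm_def)
  have "(\<lambda>n. of_int \<lceil>B\<rceil> * C * \<bar>?D n\<bar>) \<longlonglongrightarrow> 0"
    using D_class_sequence[OF S, of g p] g by (auto intro!: tendsto_eq_intros)
  show ?thesis
  proof (rule uniform_limitI)
    fix e :: real assume "e > 0"
    then have "\<forall>\<^sub>F n in sequentially. of_int \<lceil>B\<rceil> * C * \<bar>?D n\<bar> < e"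
      using \<open>(\<lambda>n. of_int \<lceil>B\<rceil> * C * \<bar>?D n\<bar>) \<longlonglongrightarrow> 0\<close> by (intro order_tendstoD)
    then show "\<forall>\<^sub>F n in sequentially. \<forall>x\<in>A. dist (f_seq p g n x) (f_lim p g x) < e"
      using eventually_ge_at_top[of "max 1 (nat \<lceil>a\<rceil>)"]
    proof eventually_elim
      case (elim n)
      show ?case
      proof
        fix x assume "x \<in> A"
        then have x: "0 < x" "x \<le> B"
          using A B by auto
        have "{real n..} \<subseteq> {a..}"
          using elim by auto
        then have "p_convex_on p {real n..} g \<or> p_concave_on p {real n..} g"
          using a p_convex_on_subset by (auto simp: p_concave_on_iff_minus)
        then have "\<bar>f_seq p g n x - f_lim p g x\<bar> \<le> of_int \<lceil>x\<rceil> * \<bar>(x - 1) gchoose p\<bar> * \<bar>?D n\<bar>"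
          using elim x by (intro abs_f_seq_minus_f_lim_le[OF S g]) auto
        also have "\<dots> \<le> of_int \<lceil>B\<rceil> * C * \<bar>?D n\<bar>"
          using x C[of x] by (intro mult_right_mono mult_mono) (auto intro: ceiling_mono)
        also have "\<dots> < e"
          by (rule elim)
        finally show "dist (f_seq p g n x) (f_lim p g x) < e"
          by (simp add: dist_real_def)
      qed
    qed
  qed
qed

theorem theorem3p6:
  fixes S :: "real set" and p :: nat and g :: "real \<Rightarrow> real"
  assumes "S \<in> {\<nat>, \<real>}"
    and "g \<in> D_class p S \<inter> K_class p"
  shows
    "g \<in> R_class p S \<and>
     ((\<forall>x>0. convergent (\<lambda>n. f_seq p g n x)) \<and>
      (\<forall>x>0. forward_diff (f_lim p g) x = g x) \<and>
      (\<forall>I. unbounded_pos_interval I \<and> p_convex_on p I g \<longrightarrow> p_concave_on p I (f_lim p g)) \<and>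
      (\<forall>I. unbounded_pos_interval I \<and> p_concave_on p I g \<longrightarrow> p_convex_on p I (f_lim p g)) \<and>
      f_lim p g 1 = 0 \<and>
      (\<forall>I. unbounded_pos_interval I \<and> (p_convex_on p I g \<or> p_concave_on p I g) \<longrightarrow>
        (\<forall>x>0. \<forall>n\<ge>1. real n \<in> I \<longrightarrow>
           \<bar>f_seq p g n x - f_lim p g x\<bar>
             \<le> of_int \<lceil>x\<rceil> * \<bar>(x - 1) gchoose p\<bar> * \<bar>(forward_diff ^^ p) g (real n)\<bar>) \<and>
        (p \<ge> 1 \<longrightarrow>
          (\<forall>x>0. \<forall>n\<ge>1. real n \<in> I \<longrightarrow>
             \<bar>f_seq p g n x - f_lim p g x\<bar>
               \<le> \<bar>(x - 1) gchoose p\<bar> *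
                 \<bar>(forward_diff ^^ (p - 1)) g (real n + x) - (forward_diff ^^ (p - 1)) g (real n)\<bar>)))) \<and>
     (\<forall>A. A \<subseteq> {0<..} \<and> bounded A \<longrightarrow> uniform_limit A (f_seq p g) (f_lim p g) sequentially)"
proof (intro conjI allI impI)
  show "g \<in> R_class p S"
    using assms by (rule subset_R_class)
  show "convergent (\<lambda>n. f_seq p g n x)" if "x > 0" for x
    using f_seq_tendsto_f_lim[OF assms that] by (auto simp: convergent_def)
  show "forward_diff (f_lim p g) x = g x" if "x > 0" for x
    using assms that by (rule forward_diff_f_lim)
  show "p_concave_on p I (f_lim p g)" if "unbounded_pos_interval I \<and> p_convex_on p I g" for I
    using that by (auto intro: p_concave_on_f_lim[OF assms])
  show "p_convex_on p I (f_lim p g)" if "unbounded_pos_interval I \<and> p_concave_on p I g" for I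
    using that by (auto intro: p_convex_on_f_lim[OF assms])
  show "f_lim p g 1 = 0"
    using assms by (rule f_lim_1)
  show "uniform_limit A (f_seq p g) (f_lim p g) sequentially" if "A \<subseteq> {0<..} \<and> bounded A" for A
    using that by (auto intro: uniform_limit_f_seq[OF assms])
  fix I and x :: real and n :: nat
  assume I: "unbounded_pos_interval I \<and> (p_convex_on p I g \<or> p_concave_on p I g)"
    and x: "0 < x" and n: "1 \<le> n" "real n \<in> I"
  have sub: "{real n..} \<subseteq> I"
    using I n unbounded_pos_interval_upward_closed by auto
  then have "p_convex_on p {real n..} g \<or> p_concave_on p {real n..} g"
    using I p_convex_on_subset by (auto simp: p_concave_on_iff_minus)
  then show "\<bar>f_seq p g n x - f_lim p g x\<bar>
      \<le> of_int \<lceil>x\<rceil> * \<bar>(x - 1) gchoose p\<bar> * \<bar>(forward_diff ^^ p) g (real n)\<bar>"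
    using n x by (intro abs_f_seq_minus_f_lim_le[OF assms]) auto
  assume p: "1 \<le> p"
  have "p_concave_on p I (f_lim p g) \<or> p_convex_on p I (f_lim p g)"
    using I p_concave_on_f_lim[OF assms] p_convex_on_f_lim[OF assms] by auto
  then have "p_convex_on p {real n..} (f_lim p g) \<or> p_concave_on p {real n..} (f_lim p g)"
    using sub p_convex_on_subset by (auto simp: p_concave_on_iff_minus)
  then show "\<bar>f_seq p g n x - f_lim p g x\<bar> \<le> \<bar>(x - 1) gchoose p\<bar> *
      \<bar>(forward_diff ^^ (p - 1)) g (real n + x) - (forward_diff ^^ (p - 1)) g (real n)\<bar>"
    using n x p by (intro abs_f_seq_minus_f_lim_le_tight[OF assms]) auto
qed

end
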